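(* Let $(X,\xi)$ and $(Y,\zeta)$ be $F$-coalgebras and $\epsilon\in\mathcal V$. For $x\in X$ and $y\in Y$, Duplicator wins the position $(x,y)$ in the codensity game up to $\epsilon$ on $\xi$ and $\zeta$ if and only if $x\preceq_{\epsilon,\Lambda}y$.
   Context: Let $\mathcal V=[0,1]$ and let $F\colon\mathbf{Set}\to\mathbf{Set}$ be a functor. Fix a set $\Lambda$ of monotone $2$-to-$\mathcal V$ predicate liftings, i.e. families $\lambda_X\colon 2^X\to\mathcal V^{FX}$ (subsets identified with $2$-valued predicates) that are natural ($\lambda_Y(A)(Ff(a))=\lambda_X(f^{-1}[A])(a)$ for $f\colon X\to Y$) and monotone in $A$. A relation $R\subseteq X\times Y$ is an $\epsilon$-$\Lambda$-simulation if $xRy$ implies $\lambda_Y(R[A])(\zeta(y))\ge\lambda_X(A)(\xi(x))-\epsilon$ for all $\lambda\in\Lambda$ and $A\subseteq X$, where $R[A]=\{y\mid\exists x\in A.\ xRy\}$. Write $x\preceq_{\epsilon,\Lambda}y$ if such an $R$ relates $x$ and $y$. The codensity game up to $\epsilon$ on $\xi,\zeta$ is played between Spoiler and Duplicator: - Positions $(x,y)\in X\times Y$ are Spoiler's. Spoiler moves to some $(A,B)\in 2^X\times 2^Y$ such that there exists $\lambda\in\Lambda$ with $\lambda_Y(B)(\zeta(y))<\lambda_X(A)(\xi(x))-\epsilon$. - Positions $(A,B)$ are Duplicator's. Duplicator moves to some $(x',y')$ with $x'\in A$ and $y'\notin B$. - A player who cannot move loses, and infinite plays are won by Duplicator. 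*)

theory Defs
  imports Complex_Main "HOL-Library.FuncSet"
begin

section \<open>Set functors, coalgebras and predicate liftings\<close>

text \<open>HOL has no type of all sets, so the category of sets is represented by the subsets of an
  arbitrary type \<open>'u\<close>, with extensional functions as morphisms. The value \<open>F X\<close> lives in a possibly
  different type \<open>'v\<close>, so that functors that increase cardinality (such as the powerset functor) are
  covered; \<open>'v = 'u\<close> is the case of an endofunctor in the narrow sense. Junk values of \<open>Fmap\<close>,
  of coalgebra structures and of predicate liftings outside their domains are irrelevant.\<close>

locale set_functor =
  fixes F :: "'u set \<Rightarrow> 'v set"
    and Fmap :: "'u set \<Rightarrow> 'u set \<Rightarrow> ('u \<Rightarrow> 'u) \<Rightarrow> 'v \<Rightarrow> 'v"
  assumes Fmap_type: "f \<in> X \<rightarrow>\<^sub>E Y \<Longrightarrow> Fmap X Y f \<in> F X \<rightarrow> F Y"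
    and Fmap_id: "a \<in> F X \<Longrightarrow> Fmap X X (\<lambda>x\<in>X. x) a = a"
    and Fmap_comp: "f \<in> X \<rightarrow>\<^sub>E Y \<Longrightarrow> g \<in> Y \<rightarrow>\<^sub>E Z \<Longrightarrow> a \<in> F X \<Longrightarrow>
      Fmap X Z (compose X g f) a = Fmap Y Z g (Fmap X Y f a)"

definition coalgebra :: "('u set \<Rightarrow> 'v set) \<Rightarrow> 'u set \<Rightarrow> ('u \<Rightarrow> 'v) \<Rightarrow> bool" where
  "coalgebra F X \<xi> \<longleftrightarrow> \<xi> \<in> X \<rightarrow> F X"

text \<open>\<open>l X A a\<close> stands for $\lambda_X(A)(a)$, where \<open>A \<subseteq> X\<close> and \<open>a \<in> F X\<close>.\<close>

type_synonym ('u, 'v) lifting = "'u set \<Rightarrow> 'u set \<Rightarrow> 'v \<Rightarrow> real"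

definition predicate_lifting ::
  "('u set \<Rightarrow> 'v set) \<Rightarrow> ('u set \<Rightarrow> 'u set \<Rightarrow> ('u \<Rightarrow> 'u) \<Rightarrow> 'v \<Rightarrow> 'v) \<Rightarrow> ('u, 'v) lifting \<Rightarrow> bool" where
  "predicate_lifting F Fmap l \<longleftrightarrow>
     (\<forall>X. \<forall>A\<subseteq>X. \<forall>a\<in>F X. l X A a \<in> {0..1}) \<and>
     (\<forall>X Y. \<forall>f \<in> X \<rightarrow>\<^sub>E Y. \<forall>A\<subseteq>Y. \<forall>a\<in>F X. l Y A (Fmap X Y f a) = l X (f -` A \<inter> X) a)"

definition monotone_lifting :: "('u set \<Rightarrow> 'v set) \<Rightarrow> ('u, 'v) lifting \<Rightarrow> bool" where
  "monotone_lifting F l \<longleftrightarrow> (\<forall>X A B. A \<subseteq> B \<and> B \<subseteq> X \<longrightarrow> (\<forall>a\<in>F X. l X A a \<le> l X B a))"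


section \<open>Simulations up to \<open>\<epsilon>\<close>\<close>

definition eps_simulation ::
  "('u, 'v) lifting set \<Rightarrow> real \<Rightarrow> 'u set \<Rightarrow> ('u \<Rightarrow> 'v) \<Rightarrow> 'u set \<Rightarrow> ('u \<Rightarrow> 'v) \<Rightarrow>
   ('u \<times> 'u) set \<Rightarrow> bool" where
  "eps_simulation \<Lambda> \<epsilon> X \<xi> Y \<zeta> R \<longleftrightarrow> R \<subseteq> X \<times> Y \<and>
     (\<forall>(x, y)\<in>R. \<forall>l\<in>\<Lambda>. \<forall>A\<subseteq>X. l Y (R `` A) (\<zeta> y) \<ge> l X A (\<xi> x) - \<epsilon>)"

definition eps_similar ::
  "('u, 'v) lifting set \<Rightarrow> real \<Rightarrow> 'u set \<Rightarrow> ('u \<Rightarrow> 'v) \<Rightarrow> 'u set \<Rightarrow> ('u \<Rightarrow> 'v) \<Rightarrow>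
   'u \<Rightarrow> 'u \<Rightarrow> bool" where
  "eps_similar \<Lambda> \<epsilon> X \<xi> Y \<zeta> x y \<longleftrightarrow> (\<exists>R. eps_simulation \<Lambda> \<epsilon> X \<xi> Y \<zeta> R \<and> (x, y) \<in> R)"


section \<open>Two-player games in which Duplicator wins infinite plays\<close>

datatype player = Spoiler | Duplicator

text \<open>A game is given by the owner of each position and the set of moves from each position.\<close>

definition partial_play :: "('p \<Rightarrow> 'p set) \<Rightarrow> 'p \<Rightarrow> 'p list \<Rightarrow> bool" where
  "partial_play moves p h \<longleftrightarrow>
     h \<noteq> [] \<and> hd h = p \<and> (\<forall>i. Suc i < length h \<longrightarrow> h ! Suc i \<in> moves (h ! i))"

datatype 'p play = Finite "'p list" | Infinite "nat \<Rightarrow> 'p"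

text \<open>Plays are maximal: a finite play ends only where its last position admits no move.\<close>

fun is_play :: "('p \<Rightarrow> 'p set) \<Rightarrow> 'p \<Rightarrow> 'p play \<Rightarrow> bool" where
  "is_play moves p (Finite h) \<longleftrightarrow> partial_play moves p h \<and> moves (last h) = {}"
| "is_play moves p (Infinite s) \<longleftrightarrow> s 0 = p \<and> (\<forall>i. s (Suc i) \<in> moves (s i))"

fun duplicator_wins_play :: "('p \<Rightarrow> player) \<Rightarrow> 'p play \<Rightarrow> bool" where
  "duplicator_wins_play owner (Finite h) \<longleftrightarrow> owner (last h) = Spoiler"
| "duplicator_wins_play owner (Infinite s) \<longleftrightarrow> True"

text \<open>A strategy maps the history of the play, whose last entry is the current position, to the next
  position. It must be legal whenever Duplicator can move at all; otherwise a strategy could exclude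
  all plays and be winning vacuously.\<close>

definition duplicator_strategy ::
  "('p \<Rightarrow> player) \<Rightarrow> ('p \<Rightarrow> 'p set) \<Rightarrow> 'p \<Rightarrow> ('p list \<Rightarrow> 'p) \<Rightarrow> bool" where
  "duplicator_strategy owner moves p \<sigma> \<longleftrightarrow>
     (\<forall>h. partial_play moves p h \<and> owner (last h) = Duplicator \<and> moves (last h) \<noteq> {} \<longrightarrow>
        \<sigma> h \<in> moves (last h))"

fun follows :: "('p \<Rightarrow> player) \<Rightarrow> ('p list \<Rightarrow> 'p) \<Rightarrow> 'p play \<Rightarrow> bool" where
  "follows owner \<sigma> (Finite h) \<longleftrightarrow>
     (\<forall>i. Suc i < length h \<and> owner (h ! i) = Duplicator \<longrightarrow> h ! Suc i = \<sigma> (take (Suc i) h))"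
| "follows owner \<sigma> (Infinite s) \<longleftrightarrow>
     (\<forall>i. owner (s i) = Duplicator \<longrightarrow> s (Suc i) = \<sigma> (map s [0..<Suc i]))"

definition duplicator_wins :: "('p \<Rightarrow> player) \<Rightarrow> ('p \<Rightarrow> 'p set) \<Rightarrow> 'p \<Rightarrow> bool" where
  "duplicator_wins owner moves p \<longleftrightarrow>
     (\<exists>\<sigma>. duplicator_strategy owner moves p \<sigma> \<and>
       (\<forall>\<pi>. is_play moves p \<pi> \<and> follows owner \<sigma> \<pi> \<longrightarrow> duplicator_wins_play owner \<pi>))"


section \<open>The codensity game up to \<open>\<epsilon>\<close>\<close>

datatype 'u position = SPos 'u 'u | DPos "'u set" "'u set"

fun codensity_owner :: "'u position \<Rightarrow> player" where
  "codensity_owner (SPos x y) = Spoiler"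
| "codensity_owner (DPos A B) = Duplicator"

fun codensity_moves ::
  "('u, 'v) lifting set \<Rightarrow> real \<Rightarrow> 'u set \<Rightarrow> ('u \<Rightarrow> 'v) \<Rightarrow> 'u set \<Rightarrow> ('u \<Rightarrow> 'v) \<Rightarrow>
   'u position \<Rightarrow> 'u position set" where
  "codensity_moves \<Lambda> \<epsilon> X \<xi> Y \<zeta> (SPos x y) =
     {DPos A B | A B. A \<subseteq> X \<and> B \<subseteq> Y \<and> (\<exists>l\<in>\<Lambda>. l Y B (\<zeta> y) < l X A (\<xi> x) - \<epsilon>)}"
| "codensity_moves \<Lambda> \<epsilon> X \<xi> Y \<zeta> (DPos A B) = {SPos x' y' | x' y'. x' \<in> A \<and> y' \<in> Y - B}"

end

(* Duplicator wins a position iff it lies in a safe set of positions, i.e. one in which every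
   move of Spoiler stays and which Duplicator can always move within. Simulations are the traces
   of safe sets on Spoiler's positions: the move (A, R[A]) witnesses any failure of the simulation
   condition and admits no reply inside R, while by monotonicity of the liftings every legal move
   (A, B) at a pair of a simulation R satisfies R[A] - B \<noteq> {}. *)
theory Submission
  imports Defs
begin

text \<open>A post-fixed point of the one-step controllable predecessor operator of Duplicator.
  Since infinite plays count as won, never getting stuck is all that Duplicator has to
  ensure.\<close>

definition safe_set :: "('p \<Rightarrow> player) \<Rightarrow> ('p \<Rightarrow> 'p set) \<Rightarrow> 'p set \<Rightarrow> bool" where
  "safe_set owner moves S \<longleftrightarrow>
     (\<forall>p\<in>S. (owner p = Spoiler \<longrightarrow> moves p \<subseteq> S) \<and>
            (owner p = Duplicator \<longrightarrow> moves p \<inter> S \<noteq> {}))"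

lemma safe_setD:
  assumes "safe_set owner moves S" "p \<in> S"
  shows "owner p = Spoiler \<Longrightarrow> moves p \<subseteq> S" and "owner p = Duplicator \<Longrightarrow> moves p \<inter> S \<noteq> {}"
  using assms by (auto simp: safe_set_def)

lemma partial_play_snoc:
  assumes "partial_play moves p h" "q \<in> moves (last h)"
  shows "partial_play moves p (h @ [q])"
proof -
  have "(h @ [q]) ! Suc i \<in> moves ((h @ [q]) ! i)" if i: "Suc i < length (h @ [q])" for i
  proof (cases "Suc i < length h")
    case True
    then show ?thesis using assms(1) by (simp add: partial_play_def nth_append)
  next
    case False
    with i have len: "length h = Suc i" by simp
    then have "last h = h ! i" by (subst last_conv_nth) auto
    with len assms(2) show ?thesis by (simp add: nth_append)
  qed
  then show ?thesis using assms(1) by (simp add: partial_play_def)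
qed

lemma follows_snoc:
  assumes "h \<noteq> []" "follows owner \<sigma> (Finite h)" "owner (last h) = Duplicator \<Longrightarrow> q = \<sigma> h"
  shows "follows owner \<sigma> (Finite (h @ [q]))"
proof -
  have "(h @ [q]) ! Suc i = \<sigma> (take (Suc i) (h @ [q]))"
    if i: "Suc i < length (h @ [q])" and own: "owner ((h @ [q]) ! i) = Duplicator" for i
  proof (cases "Suc i < length h")
    case True
    then show ?thesis using assms(2) own by (simp add: nth_append)
  next
    \<comment> \<open>The boundary index: \<open>take (Suc i) (h @ [q])\<close> is all of
      \<open>h\<close>, the history on which \<sigma> chose \<open>q\<close>.\<close>
    case False
    with i have len: "length h = Suc i" by simp
    with assms(1) have "last h = h ! i" by (simp add: last_conv_nth)
    with own len assms(3) show ?thesis by (simp add: nth_append)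
  qed
  then show ?thesis by simp
qed

text \<open>Induction along the play: safety keeps the moves of Spoiler inside \<open>S\<close>, and
  the assumption on \<sigma> does so for the replies of Duplicator.\<close>

lemma safe_set_play_positions:
  assumes safe: "safe_set owner moves S" and p: "p \<in> S" and play: "partial_play moves p h"
    and fol: "follows owner \<sigma> (Finite h)"
    and \<sigma>: "\<And>g. last g \<in> S \<Longrightarrow> owner (last g) = Duplicator \<Longrightarrow> \<sigma> g \<in> S"
    and i: "i < length h"
  shows "h ! i \<in> S"
  using i
proof (induction i)
  case 0
  then show ?case using p play by (simp add: partial_play_def hd_conv_nth)
next
  case (Suc i)
  then have hi: "h ! i \<in> S" by simp
  show ?case
  proof (cases "owner (h ! i)")
    case Spoiler
    then show ?thesis
      using safe_setD(1)[OF safe hi] play Suc.prems by (auto simp: partial_play_def)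
  next
    case Duplicator
    \<comment> \<open>The history on which \<sigma> is consulted ends at the current position, which
      lies in \<open>S\<close>.\<close>
    have "last (take (Suc i) h) = h ! i"
      using Suc.prems by (simp add: take_Suc_conv_app_nth)
    with hi Duplicator have "\<sigma> (take (Suc i) h) \<in> S" by (simp add: \<sigma>)
    then show ?thesis using fol Duplicator Suc.prems by simp
  qed
qed

lemma duplicator_wins_if_safe_set:
  assumes safe: "safe_set owner moves S" and p: "p \<in> S"
  shows "duplicator_wins owner moves p"
proof -
  \<comment> \<open>The second branch serves legality only: a strategy must answer every partial
    play, including those that have left \<open>S\<close>.\<close>
  define \<sigma> where "\<sigma> h =
    (if last h \<in> S then SOME q. q \<in> moves (last h) \<inter> S else SOME q. q \<in> moves (last h))" for h
  have \<sigma>: "\<sigma> h \<in> moves (last h) \<inter> S" if "last h \<in> S" "owner (last h) = Duplicator" for h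
    using safe_setD(2)[OF safe that] that(1) some_in_eq[of "moves (last h) \<inter> S"]
    by (simp add: \<sigma>_def)
  have "\<sigma> h \<in> moves (last h)" if "owner (last h) = Duplicator" "moves (last h) \<noteq> {}" for h
    using \<sigma>[of h] that some_in_eq[of "moves (last h)"] by (cases "last h \<in> S") (auto simp: \<sigma>_def)
  then have "duplicator_strategy owner moves p \<sigma>"
    by (simp add: duplicator_strategy_def)
  moreover have "duplicator_wins_play owner \<pi>"
    if play: "is_play moves p \<pi>" and fol: "follows owner \<sigma> \<pi>" for \<pi>
  proof (cases \<pi>)
    case (Finite h)
    with play have h: "partial_play moves p h" and stuck: "moves (last h) = {}" by auto
    then have "h \<noteq> []" by (simp add: partial_play_def)
    then have "last h \<in> S"
      using safe_set_play_positions[OF safe p h, of \<sigma> "length h - 1"] fol Finite \<sigma>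
      by (simp add: last_conv_nth)
    then have "owner (last h) \<noteq> Duplicator" using safe_setD(2)[OF safe] stuck by blast
    then show ?thesis using Finite by (cases "owner (last h)") auto
  qed simp
  ultimately show ?thesis by (auto simp: duplicator_wins_def)
qed

text \<open>Take for \<open>S\<close> the last positions of all partial plays that follow a winning
  \<sigma>. As \<sigma> depends on the history, closure is shown by extending a history that
  witnesses membership.\<close>

lemma safe_set_if_duplicator_wins:
  assumes "duplicator_wins owner moves p"
  obtains S where "safe_set owner moves S" "p \<in> S"
proof -
  from assms obtain \<sigma> where strat: "duplicator_strategy owner moves p \<sigma>"
    and win: "\<And>\<pi>. is_play moves p \<pi> \<Longrightarrow> follows owner \<sigma> \<pi> \<Longrightarrow> duplicator_wins_play owner \<pi>"
    by (auto simp: duplicator_wins_def)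
  define S where "S = {last h | h. partial_play moves p h \<and> follows owner \<sigma> (Finite h)}"
  have step: "q \<in> S"
    if h: "partial_play moves p h" "follows owner \<sigma> (Finite h)"
      and q: "q \<in> moves (last h)" "owner (last h) = Duplicator \<Longrightarrow> q = \<sigma> h" for h q
  proof -
    from h(1) have "h \<noteq> []" by (simp add: partial_play_def)
    then have "partial_play moves p (h @ [q])" "follows owner \<sigma> (Finite (h @ [q]))"
      using partial_play_snoc[OF h(1) q(1)] follows_snoc[OF _ h(2) q(2)] by blast+
    then show ?thesis unfolding S_def by (intro CollectI exI[of _ "h @ [q]"]) simp
  qed
  have "safe_set owner moves S"
    unfolding safe_set_def
  proof (intro ballI conjI impI)
    fix r assume "r \<in> S" and "owner r = Spoiler"
    then show "moves r \<subseteq> S" using step by (force simp: S_def)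
  next
    fix r assume "r \<in> S" and own: "owner r = Duplicator"
    then obtain h where r: "r = last h" and h: "partial_play moves p h"
      and fol: "follows owner \<sigma> (Finite h)"
      by (auto simp: S_def)
    \<comment> \<open>Otherwise \<open>h\<close> would be a maximal play that follows \<sigma> and
      is lost by Duplicator.\<close>
    have "moves r \<noteq> {}"
      using win[of "Finite h"] h fol own r by auto
    with strat h own r have "\<sigma> h \<in> moves r" by (simp add: duplicator_strategy_def)
    moreover from this have "\<sigma> h \<in> S" using step[OF h fol] r by simp
    ultimately show "moves r \<inter> S \<noteq> {}" by blast
  qed
  moreover have "partial_play moves p [p]" "follows owner \<sigma> (Finite [p])"
    by (simp_all add: partial_play_def)
  then have "p \<in> S" unfolding S_def by (intro CollectI exI[of _ "[p]"]) simp
  ultimately show thesis by (rule that)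
qed

text \<open>\<open>S\<close> may contain positions outside the carriers. Cutting \<open>R\<close>
  down to \<open>X \<times> Y\<close> puts R[A] inside \<open>Y\<close>, which makes (A, R[A]) a
  legal choice for Spoiler.\<close>

lemma eps_simulation_if_safe_set:
  fixes \<Lambda> :: "('u, 'v) lifting set" and S :: "'u position set"
  assumes safe: "safe_set codensity_owner (codensity_moves \<Lambda> \<epsilon> X \<xi> Y \<zeta>) S"
  defines "R \<equiv> {(x, y) \<in> X \<times> Y. SPos x y \<in> S}"
  shows "eps_simulation \<Lambda> \<epsilon> X \<xi> Y \<zeta> R"
proof -
  have "l Y (R `` A) (\<zeta> y) \<ge> l X A (\<xi> x) - \<epsilon>"
    if xy: "(x, y) \<in> R" and l: "l \<in> \<Lambda>" and A: "A \<subseteq> X" for x y l A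
  proof (rule ccontr)
    assume "\<not> ?thesis"
    then have "DPos A (R `` A) \<in> codensity_moves \<Lambda> \<epsilon> X \<xi> Y \<zeta> (SPos x y)"
      using l A by (force simp: R_def)
    moreover have "SPos x y \<in> S" using xy by (simp add: R_def)
    ultimately have "DPos A (R `` A) \<in> S" using safe_setD(1)[OF safe] by fastforce
    then have "codensity_moves \<Lambda> \<epsilon> X \<xi> Y \<zeta> (DPos A (R `` A)) \<inter> S \<noteq> {}"
      using safe_setD(2)[OF safe] by fastforce
    then obtain x' y' where "x' \<in> A" "y' \<in> Y - R `` A" "SPos x' y' \<in> S" by auto
    \<comment> \<open>With \<open>A \<subseteq> X\<close> the reply is a pair in \<open>R\<close>,
      which puts \<open>y'\<close> into R[A].\<close>
    then show False using A by (auto simp: R_def)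
  qed
  then show ?thesis by (auto simp: eps_simulation_def R_def)
qed

text \<open>At \<open>DPos A B\<close> some \<open>y'\<close> in R[A] lies outside \<open>B\<close>;
  an \<open>R\<close>-predecessor of it in \<open>A\<close> completes a reply inside
  \<open>R\<close>. The work lies in showing that the moves of Spoiler lead to such
  positions.\<close>

lemma safe_set_if_eps_simulation:
  assumes mono: "\<And>l. l \<in> \<Lambda> \<Longrightarrow> monotone_lifting F l"
    and coalg: "coalgebra F Y \<zeta>"
    and sim: "eps_simulation \<Lambda> \<epsilon> X \<xi> Y \<zeta> R"
  shows "safe_set codensity_owner (codensity_moves \<Lambda> \<epsilon> X \<xi> Y \<zeta>)
    ({SPos x y | x y. (x, y) \<in> R} \<union> {DPos A B | A B. \<not> R `` A \<subseteq> B})"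
proof -
  have RXY: "R \<subseteq> X \<times> Y" using sim by (simp add: eps_simulation_def)
  have "\<not> R `` A \<subseteq> B"
    if xy: "(x, y) \<in> R" and A: "A \<subseteq> X" and B: "B \<subseteq> Y" and l: "l \<in> \<Lambda>"
      and less: "l Y B (\<zeta> y) < l X A (\<xi> x) - \<epsilon>" for x y A B l
  proof
    assume "R `` A \<subseteq> B"
    moreover have "\<zeta> y \<in> F Y" using coalg xy RXY by (auto simp: coalgebra_def)
    \<comment> \<open>Enlarging R[A] to \<open>B\<close> can only raise the value at \<zeta> y, so
      the simulation bound carries over to \<open>B\<close> and contradicts the legality of the
      move.\<close>
    ultimately have "l Y (R `` A) (\<zeta> y) \<le> l Y B (\<zeta> y)"
      using mono[OF l] B by (simp add: monotone_lifting_def)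
    moreover have "l X A (\<xi> x) - \<epsilon> \<le> l Y (R `` A) (\<zeta> y)"
      using sim xy l A by (auto simp: eps_simulation_def)
    ultimately show False using less by simp
  qed
  then show ?thesis using RXY by (fastforce simp: safe_set_def)
qed

theorem theorem4p2:
  fixes F :: "'u set \<Rightarrow> 'v set"
    and Fmap :: "'u set \<Rightarrow> 'u set \<Rightarrow> ('u \<Rightarrow> 'u) \<Rightarrow> 'v \<Rightarrow> 'v"
    and \<Lambda> :: "('u, 'v) lifting set"
    and X Y :: "'u set"
    and \<xi> \<zeta> :: "'u \<Rightarrow> 'v"
    and \<epsilon> :: real
    and x y :: 'u
  assumes "set_functor F Fmap"
    and "\<And>l. l \<in> \<Lambda> \<Longrightarrow> predicate_lifting F Fmap l"
    and "\<And>l. l \<in> \<Lambda> \<Longrightarrow> monotone_lifting F l"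
    and "coalgebra F X \<xi>"
    and "coalgebra F Y \<zeta>"
    and "\<epsilon> \<in> {0..1}"
    and "x \<in> X"
    and "y \<in> Y"
  shows "duplicator_wins codensity_owner (codensity_moves \<Lambda> \<epsilon> X \<xi> Y \<zeta>) (SPos x y)
    \<longleftrightarrow> eps_similar \<Lambda> \<epsilon> X \<xi> Y \<zeta> x y"
proof
  assume "duplicator_wins codensity_owner (codensity_moves \<Lambda> \<epsilon> X \<xi> Y \<zeta>) (SPos x y)"
  then obtain S where "safe_set codensity_owner (codensity_moves \<Lambda> \<epsilon> X \<xi> Y \<zeta>) S" "SPos x y \<in> S"
    by (rule safe_set_if_duplicator_wins)
  then show "eps_similar \<Lambda> \<epsilon> X \<xi> Y \<zeta> x y"
    using eps_simulation_if_safe_set[of \<Lambda> \<epsilon> X \<xi> Y \<zeta> S] assms(7,8)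
    by (auto simp: eps_similar_def)
next
  assume "eps_similar \<Lambda> \<epsilon> X \<xi> Y \<zeta> x y"
  then obtain R where "eps_simulation \<Lambda> \<epsilon> X \<xi> Y \<zeta> R" "(x, y) \<in> R"
    by (auto simp: eps_similar_def)
  then show "duplicator_wins codensity_owner (codensity_moves \<Lambda> \<epsilon> X \<xi> Y \<zeta>) (SPos x y)"
    using duplicator_wins_if_safe_set[OF safe_set_if_eps_simulation[OF assms(3,5)]] by blast
qed

end
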